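(* Let $k \in \mathbb{N}$. There exists a recurrent infinite word $\omega \in \{0,1,2,\dots,2k\}^{\mathbb{N}}$ having $\rho_\omega^{\Sigma}(n) = 2k+1$ for all $n \in \mathbb{N}$.
   Context: $\mathbb{N}$ denotes the positive integers. For a set $S$ of integers, $S^{\mathbb{N}}$ is the set of infinite words $\omega = x_1x_2x_3\cdots$ with $x_i\in S$. For $m\le n$, $\omega[m,n] = x_mx_{m+1}\cdots x_n$; factors of $\omega$ are the finite words of this form, and $\mathcal{F}^n(\omega)$ is the set of factors of length $n$. $\omega$ is recurrent if each of its factors occurs infinitely often (i.e. equals $\omega[m,n]$ for infinitely many $m$). $\sum B$ is the sum of the letters of a finite word $B$. The additive complexity of $\omega$ is $\rho_\omega^{\Sigma}(n) = |\{\sum B : B\in\mathcal{F}^n(\omega)\}|$. *)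

theory Defs
  imports Complex_Main "HOL-Library.Stream"
begin

text \<open>
  Infinite words \<open>x\<^sub>1 x\<^sub>2 x\<^sub>3 \<dots>\<close> are streams and finite words are lists, so that
  \<open>streams S\<close> is the set of infinite words over \<open>S\<close>. Positions in a word start at 1,
  whereas \<open>!!\<close> counts from 0: the letter \<open>x\<^sub>i\<close> of \<open>w\<close> is \<open>w !! (i - 1)\<close>.
\<close>

text \<open>The word \<open>x\<^sub>m \<dots> x\<^sub>n\<close>; only meaningful for \<open>1 \<le> m \<le> n\<close>.\<close>

definition subword :: "'a stream \<Rightarrow> nat \<Rightarrow> nat \<Rightarrow> 'a list" where
  "subword w m n = map (\<lambda>i. w !! (i - 1)) [m..<Suc n]"

definition factors :: "'a stream \<Rightarrow> 'a list set" where
  "factors w = {subword w m n | m n. 1 \<le> m \<and> m \<le> n}"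

definition factors_of_length :: "nat \<Rightarrow> 'a stream \<Rightarrow> 'a list set" where
  "factors_of_length n w = {B \<in> factors w. length B = n}"

definition recurrent :: "'a stream \<Rightarrow> bool" where
  "recurrent w \<longleftrightarrow>
     (\<forall>B \<in> factors w. infinite {m. 1 \<le> m \<and> (\<exists>n\<ge>m. subword w m n = B)})"

definition additive_complexity :: "int stream \<Rightarrow> nat \<Rightarrow> nat" where
  "additive_complexity w n = card (sum_list ` factors_of_length n w)"

end

theory Submission
  imports Defs "HOL-Library.Countable_Set"
begin

text \<open>
  Take a word \<open>s\<close> over \<open>{0..k}\<close> that contains every finite word over \<open>{0..k}\<close> as a factor, and
  let \<open>w\<close> be its sequence of differences, shifted by \<open>k\<close>. The sum of a factor of length \<open>n\<close> of \<open>w\<close>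
  telescopes to \<open>n k\<close> plus the difference of two letters of \<open>s\<close> at distance \<open>n\<close>, and since \<open>s\<close>
  contains all finite words, that difference takes exactly the values \<open>-k, \<dots>, k\<close>, whatever
  \<open>n\<close> is. Every finite word, preceded by an arbitrarily long padding, occurs in \<open>s\<close>, so \<open>w\<close> is
  recurrent.
\<close>

text \<open>Locates a block inside a concatenation. Since no block is empty, \<open>flat\<close>
  unfolds by whole blocks, and the prefix \<open>u\<close> collects the first \<open>j\<close> of
  them.\<close>

lemma shift_flat_decomp:
  assumes "\<And>xs. xs \<in> sset W \<Longrightarrow> xs \<noteq> []"
  shows "\<exists>u. flat W = u @- (W !! j) @- flat (sdrop (Suc j) W)"
  using assms
proof (induction j arbitrary: W)
  case 0
  have "flat W = [] @- (W !! 0) @- flat (sdrop (Suc 0) W)"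
    using 0 by (cases W) simp
  then show ?case by blast
next
  case (Suc j)
  have ne: "xs \<noteq> []" if "xs \<in> sset (stl W)" for xs
    using that by (rule Suc.prems[OF stl_sset])
  obtain u where u: "flat (stl W) = u @- (stl W !! j) @- flat (sdrop (Suc j) (stl W))"
    using Suc.IH[OF ne] by blast
  have "flat W = shd W @- flat (stl W)"
    by (rule flat_unfold[OF Suc.prems[OF shd_sset]])
  then have "flat W = (shd W @ u) @- (W !! Suc j) @- flat (sdrop (Suc (Suc j)) W)"
    using u by simp
  then show ?case by blast
qed

lemma flat_streams:
  assumes "\<And>xs. xs \<in> sset W \<Longrightarrow> xs \<noteq> [] \<and> xs \<in> lists A"
  shows "flat W \<in> streams A"
proof -
  have "sset (flat W) \<subseteq> A"
    using assms by (subst sset_flat) (auto simp: in_lists_conv_set)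
  then show ?thesis by (rule sset_streams)
qed

text \<open>A countable alphabet has countably many finite words, so they can be enumerated and
  concatenated; each then occurs as a block.\<close>

lemma disjunctive_stream_exists:
  assumes "countable A" "A \<noteq> {}"
  shows "\<exists>s \<in> streams A. \<forall>l \<in> lists A. \<exists>p. \<forall>i < length l. s !! (p + i) = l ! i"
proof -
  \<comment> \<open>The empty word is left out so that \<open>flat\<close> can be unfolded block by
    block; for it the claim is vacuous.\<close>
  define L where "L = lists A - {[]}"
  have "countable L" unfolding L_def using assms by auto
  moreover obtain a where a: "a \<in> A" using assms by blast
  then have "[a] \<in> L" by (simp add: L_def)
  ultimately have rng: "range (from_nat_into L) = L"
    by (metis empty_iff range_from_nat_into)
  define W where "W = smap (from_nat_into L) nats"
  have sset_W: "sset W = L"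
    using rng by (simp add: W_def sset_range image_image snth_smap)
  have "flat W \<in> streams A"
    by (rule flat_streams) (auto simp: sset_W L_def)
  moreover have "\<exists>p. \<forall>i < length l. flat W !! (p + i) = l ! i" if l: "l \<in> lists A" for l
  proof (cases "l = []")
    case False
    then obtain j where j: "W !! j = l"
      using l sset_W by (metis L_def Diff_iff singletonD snth_sset sset_range imageE)
    obtain u where "flat W = u @- l @- flat (sdrop (Suc j) W)"
      using shift_flat_decomp[of W j] j sset_W by (auto simp: L_def)
    then have "flat W !! (length u + i) = l ! i" if "i < length l" for i
      using that by simp
    then show ?thesis by blast
  qed simp
  ultimately show ?thesis by blast
qed

lemma length_subword [simp]: "length (subword w m n) = Suc n - m"
  by (simp add: subword_def del: upt_Suc)

definition diff_stream :: "int \<Rightarrow> int stream \<Rightarrow> int stream" where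
  "diff_stream c s = smap (\<lambda>i. c + s !! Suc i - s !! i) nats"

lemma diff_stream_snth [simp]: "diff_stream c s !! i = c + s !! Suc i - s !! i"
  by (simp add: diff_stream_def)

lemma diff_stream_streams:
  assumes "s \<in> streams {0..c}"
  shows "diff_stream c s \<in> streams {0..2 * c}"
proof -
  have "s !! i \<in> {0..c}" for i using assms by (rule snth_in)
  then have "0 \<le> s !! i" "s !! i \<le> c" for i by simp_all
  then have "0 \<le> c + s !! Suc i - s !! i" "c + s !! Suc i - s !! i \<le> 2 * c" for i
    by (smt (verit))+
  then show ?thesis by (simp add: streams_iff_snth del: snth.simps)
qed

text \<open>The differences telescope. In \<open>subword\<close> positions start at 1, hence
  \<open>Suc p\<close>, while \<open>s !! p\<close> counts from 0.\<close>

lemma sum_list_subword_diff_stream: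
  "sum_list (subword (diff_stream c s) (Suc p) (p + n)) = int n * c + (s !! (p + n) - s !! p)"
  by (induction n) (auto simp: subword_def algebra_simps)

text \<open>A factor of \<open>n\<close> differences is determined by \<open>n + 1\<close>
  consecutive letters of \<open>s\<close>, hence the bound \<open>i \<le> n\<close>.\<close>

lemma subword_diff_stream_cong:
  assumes "\<And>i. i \<le> n \<Longrightarrow> s !! (q + i) = s !! (p + i)"
  shows "subword (diff_stream c s) (Suc q) (q + n) = subword (diff_stream c s) (Suc p) (p + n)"
proof (rule nth_equalityI)
  fix i assume "i < length (subword (diff_stream c s) (Suc q) (q + n))"
  then have "i < n" by simp
  then show "subword (diff_stream c s) (Suc q) (q + n) ! i
           = subword (diff_stream c s) (Suc p) (p + n) ! i"
    using assms[of i] assms[of "Suc i"] by (simp add: subword_def del: upt_Suc)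
qed simp

text \<open>Describes a factor of length \<open>n\<close> by its starting point \<open>p\<close>
  counted from 0, the form in which the sums telescope.\<close>

lemma sum_list_factors_of_length:
  assumes "n \<ge> 1"
  shows "sum_list ` factors_of_length n w = range (\<lambda>p. sum_list (subword w (Suc p) (p + n)))"
proof -
  have "factors_of_length n w = range (\<lambda>p. subword w (Suc p) (p + n))"
  proof (intro equalityI subsetI)
    fix B assume "B \<in> factors_of_length n w"
    then obtain m n' where "B = subword w m n'" "1 \<le> m" "m \<le> n'" "length B = n"
      by (auto simp: factors_of_length_def factors_def)
    then have "B = subword w (Suc (m - 1)) (m - 1 + n)"
      by (auto simp: le_Suc_eq Suc_diff_le)
    then show "B \<in> range (\<lambda>p. subword w (Suc p) (p + n))" by blast
  next
    fix B assume "B \<in> range (\<lambda>p. subword w (Suc p) (p + n))"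
    then obtain p where B: "B = subword w (Suc p) (p + n)" by blast
    moreover have "1 \<le> Suc p" "Suc p \<le> p + n" using assms by auto
    ultimately have "B \<in> factors w" unfolding factors_def by blast
    then show "B \<in> factors_of_length n w" by (simp add: factors_of_length_def B)
  qed
  then show ?thesis by (simp add: image_image)
qed

lemma recurrent_diff_stream:
  assumes s: "s \<in> streams A"
    and disj: "\<And>l. l \<in> lists A \<Longrightarrow> \<exists>p. \<forall>i < length l. s !! (p + i) = l ! i"
  shows "recurrent (diff_stream c s)"
  unfolding recurrent_def
proof
  fix B assume "B \<in> factors (diff_stream c s)"
  then obtain m n where B: "B = subword (diff_stream c s) m n" "1 \<le> m" "m \<le> n"
    by (auto simp: factors_def)
  \<comment> \<open>\<open>p\<close> is the start of \<open>B\<close> counted from 0 and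
    \<open>d\<close> is its length.\<close>
  define p d where "p = m - 1" and "d = n - p"
  have pd: "B = subword (diff_stream c s) (Suc p) (p + d)" "d \<ge> 1"
    using B by (auto simp: p_def d_def)
  have "\<exists>q\<ge>N. 1 \<le> q \<and> (\<exists>n\<ge>q. subword (diff_stream c s) q n = B)" for N
  proof -
    \<comment> \<open>The last \<open>d + 1\<close> letters of \<open>l\<close> are those of
      \<open>s\<close> that determine \<open>B\<close>. The prefix of \<open>s\<close> before them
      is padding of length \<open>N\<close> over \<open>A\<close>: if \<open>l\<close> occurs at
      \<open>r\<close>, these letters recur at \<open>r + N\<close>, so \<open>B\<close> reappears
      beyond \<open>N\<close>.\<close>
    define l where "l = stake N s @ stake (Suc d) (sdrop p s)"
    have "set l \<subseteq> sset s"
      by (auto simp: l_def sset_range in_set_conv_nth sdrop_snth simp del: stake.simps)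
    then have "l \<in> lists A"
      using s by (auto simp: streams_iff_sset in_lists_conv_set)
    then obtain r where r: "\<And>i. i < length l \<Longrightarrow> s !! (r + i) = l ! i" using disj by blast
    have "s !! (r + N + i) = s !! (p + i)" if "i \<le> d" for i
      using r[of "N + i"] that
      by (simp add: l_def nth_append sdrop_snth add.assoc del: stake.simps)
    then have "subword (diff_stream c s) (Suc (r + N)) (r + N + d) = B"
      using subword_diff_stream_cong pd(1) by metis
    moreover have "Suc (r + N) \<ge> N" "1 \<le> Suc (r + N)" "r + N + d \<ge> Suc (r + N)"
      using pd(2) by auto
    ultimately show ?thesis by blast
  qed
  then show "infinite {m. 1 \<le> m \<and> (\<exists>n\<ge>m. subword (diff_stream c s) m n = B)}"
    unfolding infinite_nat_iff_unbounded_le by blast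
qed

lemma additive_complexity_diff_stream:
  assumes s: "s \<in> streams {0..int k}"
    and disj: "\<And>l. l \<in> lists {0..int k} \<Longrightarrow> \<exists>p. \<forall>i < length l. s !! (p + i) = l ! i"
    and n: "n \<ge> 1"
  shows "additive_complexity (diff_stream (int k) s) n = 2 * k + 1"
proof -
  have bounds: "0 \<le> s !! i" "s !! i \<le> int k" for i
    using snth_in[OF s, of i] by auto
  have "range (\<lambda>p. s !! (p + n) - s !! p) = {- int k..int k}"
  proof (intro equalityI subsetI)
    fix d assume "d \<in> range (\<lambda>p. s !! (p + n) - s !! p)"
    then obtain p where "d = s !! (p + n) - s !! p" by blast
    then show "d \<in> {- int k..int k}" using bounds[of p] bounds[of "p + n"] by simp
  next
    fix d assume d: "d \<in> {- int k..int k}"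
    \<comment> \<open>A word of length \<open>n + 1\<close> whose end letters lie in
      \<open>{0..int k}\<close> and differ by \<open>d\<close>, as
      \<open>max 0 d - max 0 (- d) = d\<close>. The zeros put the ends at distance
      \<open>n\<close>.\<close>
    define l where "l = max 0 (- d) # replicate (n - 1) 0 @ [max 0 d]"
    have "l \<in> lists {0..int k}" using d by (auto simp: l_def in_lists_conv_set)
    then obtain p where p: "\<And>i. i < length l \<Longrightarrow> s !! (p + i) = l ! i" using disj by blast
    have "s !! p = max 0 (- d)" using p[of 0] by (simp add: l_def)
    moreover have "s !! (p + n) = max 0 d"
      using p[of n] n by (simp add: l_def nth_append)
    ultimately have "d = s !! (p + n) - s !! p" by simp
    then show "d \<in> range (\<lambda>p. s !! (p + n) - s !! p)" by blast
  qed
  moreover have "sum_list ` factors_of_length n (diff_stream (int k) s)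
      = (+) (int n * int k) ` range (\<lambda>p. s !! (p + n) - s !! p)"
    unfolding sum_list_factors_of_length[OF n] sum_list_subword_diff_stream
    by (simp add: image_image)
  ultimately have "additive_complexity (diff_stream (int k) s) n
      = card ((+) (int n * int k) ` {- int k..int k})"
    by (simp only: additive_complexity_def)
  also have "\<dots> = card {- int k..int k}" by (rule card_image) simp
  finally show ?thesis by simp
qed

theorem theorem4p1:
  fixes k :: nat
  assumes "k \<ge> 1"
  shows "\<exists>w \<in> streams {0..2 * int k}.
           recurrent w \<and> (\<forall>n\<ge>1. additive_complexity w n = 2 * k + 1)"
proof -
  have "countable {0..int k}" "{0..int k} \<noteq> {}" by auto
  then obtain s where s: "s \<in> streams {0..int k}"
    and disj: "\<And>l. l \<in> lists {0..int k} \<Longrightarrow> \<exists>p. \<forall>i < length l. s !! (p + i) = l ! i"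
    using disjunctive_stream_exists by metis
  show ?thesis
  proof (intro bexI conjI allI impI)
    show "diff_stream (int k) s \<in> streams {0..2 * int k}"
      by (rule diff_stream_streams[OF s])
    show "recurrent (diff_stream (int k) s)"
      by (rule recurrent_diff_stream[OF s disj])
    show "additive_complexity (diff_stream (int k) s) n = 2 * k + 1" if "n \<ge> 1" for n
      by (rule additive_complexity_diff_stream[OF s disj that])
  qed
qed

end
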